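(* Let $m$ be a positive integer and $k$ a nonnegative integer. The map $\psi$ (for the poset $P'(2m+2,2k+1)$) induces a bijection between the set $J^*(P'(2m+2,2k+1))$ and the set $\mathcal{Q}^*(m+1,k)$.
   Context: Poset $P'(s,K)$: $L'(s,K)=\bigcup_{j\ge0}\{(i-\tfrac{K}{2}j, j): i\in\mathbb{Z}, jK+1\le i\le\lfloor s/2\rfloor\}$, $R'(s,K)=\bigcup_{j\ge0}\{(s+1-i+\tfrac{K}{2}(j+1), -j-1): i\in\mathbb{Z}, jK+\lceil(s+K)/2\rceil+1\le i\le s\}$, $P'(s,K)=L'\cup R'$ with the partial order generated by: within $L'$, $(a,b)$ covers $(a',b')$ iff $|a-a'|\le K/2$ and $b=b'+1$; within $R'$, $(a,b)$ covers $(a',b')$ iff $|a-a'|\le K/2$ and $b=b'-1$. $J(P'(s,K))$ is the set of order ideals of $P'(s,K)$ containing no two elements $(a,0)$, $(a',-1)$ with $|a-a'|\le K/2$. $J^*(P'(2m+2,2k+1))$ is the set of $I\in J(P'(2m+2,2k+1))$ with $(m+1,0)\notin I$. Paths: a free ballot $(s,K)$-path of height $n$ is a lattice path from $(0,0)$ to $(s,n)$ with steps $(K/2,1)$, $(K/2,-1)$, $(\ell,0)$ ($\ell$ an integer, $1\le\ell<K$), allowed below the $x$-axis; $\mathcal{FB}'_n(s,K)$ is the set of those whose first step is horizontal or down. For a positive integer $M$, $\mathcal{Q}'(M,k)=\bigl(\bigcup_{i=0}^{k-1}\mathcal{FB}'_0(M-i,2k+1)\bigr)\cup\mathcal{FB}'_{-1}(M+\tfrac12,2k+1)$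 and $\mathcal{Q}^*(M,k)=\mathcal{Q}'(M,k)\setminus\mathcal{FB}'_0(M,2k+1)$. The map $\psi$ on $J(P'(2M,2k+1))$ (here $M=m+1$): a point $(x,y)$ is visible if $y$ is an even integer and $x\in\mathbb{Z}$, or $y$ is an odd integer and $x\in\mathbb{Z}+\tfrac12$. For $I$, color each visible point $(a,b)$ with $0\le a\le M+\tfrac12$: if $b\ge0$ it is black iff $(a,b)\in I$; if $b<0$ it is black iff $(a,b)\notin I$; all other points count as not black. Set $P_0=(0,0)$ and, given $P_{i-1}=(a,b)$: (Case 1) if some $(a+\ell,b)$ with integer $1\le\ell\le 2k$ is black, set $P_i=(a+k+\tfrac12,b+1)$ if that point is black, and otherwise $P_i=(a+\ell,b)$ for the smallest such $\ell$; (Case 2) otherwise, set $P_i=(a+k+\tfrac12,b-1)$ if that point is black, and otherwise stop with $n=i-1$. $\psi(I)$ is the path with successive points $P_0,\ldots,P_n$.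
   Formalization: Here k is assumed positive: for k = 0 the map ψ is never such a bijection (for m = 1, k = 0 the set J* has 3 elements and Q* has 6). The path without steps is counted in FB'_0(0,2k+1). *)

theory Defs
  imports Complex_Main
begin

text \<open>Abscissas are half-integers, so points are modelled as pairs of a real and an integer.\<close>

type_synonym point = "real \<times> int"

section \<open>The poset and its order ideals\<close>

definition L' :: "nat \<Rightarrow> nat \<Rightarrow> point set" where
  "L' s K = (\<Union>j::nat. {(real_of_int i - real K / 2 * real j, int j) | i :: int.
     int j * int K + 1 \<le> i \<and> i \<le> \<lfloor>real s / 2\<rfloor>})"

definition R' :: "nat \<Rightarrow> nat \<Rightarrow> point set" where
  "R' s K = (\<Union>j::nat. {(real s + 1 - real_of_int i + real K / 2 * (real j + 1), - int j - 1) | i :: int.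
     int j * int K + \<lceil>(real s + real K) / 2\<rceil> + 1 \<le> i \<and> i \<le> int s})"

definition P' :: "nat \<Rightarrow> nat \<Rightarrow> point set" where
  "P' s K = L' s K \<union> R' s K"

definition covers :: "nat \<Rightarrow> nat \<Rightarrow> point \<Rightarrow> point \<Rightarrow> bool" where
  "covers s K p q \<longleftrightarrow>
     (p \<in> L' s K \<and> q \<in> L' s K \<and> \<bar>fst p - fst q\<bar> \<le> real K / 2 \<and> snd p = snd q + 1) \<or>
     (p \<in> R' s K \<and> q \<in> R' s K \<and> \<bar>fst p - fst q\<bar> \<le> real K / 2 \<and> snd p = snd q - 1)"

definition poset_le :: "nat \<Rightarrow> nat \<Rightarrow> point \<Rightarrow> point \<Rightarrow> bool" where
  "poset_le s K = (\<lambda>q p. covers s K p q)\<^sup>*\<^sup>*"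

definition order_ideal :: "nat \<Rightarrow> nat \<Rightarrow> point set \<Rightarrow> bool" where
  "order_ideal s K I \<longleftrightarrow> I \<subseteq> P' s K \<and> (\<forall>p\<in>I. \<forall>q\<in>P' s K. poset_le s K q p \<longrightarrow> q \<in> I)"

definition J :: "nat \<Rightarrow> nat \<Rightarrow> point set set" where
  "J s K = {I. order_ideal s K I \<and>
     \<not> (\<exists>a a'. (a, 0) \<in> I \<and> (a', -1) \<in> I \<and> \<bar>a - a'\<bar> \<le> real K / 2)}"

definition Jstar :: "nat \<Rightarrow> nat \<Rightarrow> point set set" where
  "Jstar m k = {I \<in> J (2 * m + 2) (2 * k + 1). (real m + 1, 0) \<notin> I}"

section \<open>Free ballot paths\<close>

text \<open>A lattice path is represented by the nonempty list of its successive points.\<close>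

definition is_step :: "nat \<Rightarrow> point \<Rightarrow> point \<Rightarrow> bool" where
  "is_step K p q \<longleftrightarrow>
     (fst q - fst p = real K / 2 \<and> snd q - snd p = 1) \<or>
     (fst q - fst p = real K / 2 \<and> snd q - snd p = -1) \<or>
     (\<exists>l::nat. 1 \<le> l \<and> l < K \<and> fst q - fst p = real l \<and> snd q - snd p = 0)"

definition FB :: "int \<Rightarrow> real \<Rightarrow> nat \<Rightarrow> point list set" where
  "FB n s K = {ps. ps \<noteq> [] \<and> hd ps = (0, 0) \<and> last ps = (s, n) \<and> successively (is_step K) ps}"

text \<open>The path without steps has no first step that could go up; it is counted as an element
  of \<open>FB' 0 0 K\<close>. This matters for \<open>k > M\<close> below, where it is the image of the empty ideal.\<close>

definition FB' :: "int \<Rightarrow> real \<Rightarrow> nat \<Rightarrow> point list set" where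
  "FB' n s K = {ps \<in> FB n s K. length ps \<ge> 2 \<longrightarrow> snd (ps ! 1) - snd (ps ! 0) \<in> {0, -1}}"

definition Q' :: "nat \<Rightarrow> nat \<Rightarrow> point list set" where
  "Q' M k = (\<Union>i<k. FB' 0 (real M - real i) (2 * k + 1)) \<union> FB' (-1) (real M + 1 / 2) (2 * k + 1)"

definition Qstar :: "nat \<Rightarrow> nat \<Rightarrow> point list set" where
  "Qstar M k = Q' M k - FB' 0 (real M) (2 * k + 1)"

section \<open>The map from ideals to paths\<close>

definition visible :: "point \<Rightarrow> bool" where
  "visible p \<longleftrightarrow> (even (snd p) \<and> fst p \<in> \<int>) \<or> (odd (snd p) \<and> fst p - 1 / 2 \<in> \<int>)"

definition black :: "nat \<Rightarrow> point set \<Rightarrow> point \<Rightarrow> bool" where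
  "black M I p \<longleftrightarrow> visible p \<and> 0 \<le> fst p \<and> fst p \<le> real M + 1 / 2 \<and>
     (if snd p \<ge> 0 then p \<in> I else p \<notin> I)"

definition next_point :: "nat \<Rightarrow> nat \<Rightarrow> point set \<Rightarrow> point \<Rightarrow> point option" where
  "next_point M k I = (\<lambda>(a, b).
     if \<exists>l::nat. 1 \<le> l \<and> l \<le> 2 * k \<and> black M I (a + real l, b) then
       if black M I (a + real k + 1 / 2, b + 1) then Some (a + real k + 1 / 2, b + 1)
       else Some (a + real (LEAST l::nat. 1 \<le> l \<and> l \<le> 2 * k \<and> black M I (a + real l, b)), b)
     else
       if black M I (a + real k + 1 / 2, b - 1) then Some (a + real k + 1 / 2, b - 1)
       else None)"

lemma next_point_advances:
  assumes "next_point M k I p = Some q"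
  shows "fst p + 1 / 2 \<le> fst q" and "fst q \<le> real M + 1 / 2"
proof -
  obtain a b where p: "p = (a, b)" by (cases p)
  let ?P = "\<lambda>l::nat. 1 \<le> l \<and> l \<le> 2 * k \<and> black M I (a + real l, b)"
  have least: "?P (LEAST l. ?P l)" if "\<exists>l. ?P l"
    using that by (rule LeastI_ex)
  consider "q = (a + real k + 1 / 2, b + 1)" "black M I q"
    | "q = (a + real (LEAST l. ?P l), b)" "\<exists>l. ?P l"
    | "q = (a + real k + 1 / 2, b - 1)" "black M I q"
    using assms unfolding p next_point_def by (auto split: if_splits)
  then have "fst p + 1 / 2 \<le> fst q \<and> fst q \<le> real M + 1 / 2"
  proof cases
    case 2
    from least[OF 2(2)] 2(1) show ?thesis by (auto simp: p black_def)
  qed (auto simp: p black_def)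
  then show "fst p + 1 / 2 \<le> fst q" and "fst q \<le> real M + 1 / 2" by auto
qed

function path_from :: "nat \<Rightarrow> nat \<Rightarrow> point set \<Rightarrow> point \<Rightarrow> point list" where
  "path_from M k I p =
     p # (case next_point M k I p of None \<Rightarrow> [] | Some q \<Rightarrow> path_from M k I q)"
  by pat_completeness auto
termination
proof (relation "measure (\<lambda>(M, k, I, p). nat \<lfloor>2 * (real M + 1 - fst p)\<rfloor>)")
  fix M k I and p q :: point
  assume "next_point M k I p = Some q"
  note adv = next_point_advances[OF this]
  have "\<lfloor>2 * (real M + 1 - fst q)\<rfloor> + 1 \<le> \<lfloor>2 * (real M + 1 - fst p)\<rfloor>"
    using adv by (simp add: le_floor_iff) linarith
  moreover have "0 \<le> \<lfloor>2 * (real M + 1 - fst q)\<rfloor>"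
    using adv by simp
  ultimately show "((M, k, I, q), (M, k, I, p)) \<in>
      measure (\<lambda>(M, k, I, p). nat \<lfloor>2 * (real M + 1 - fst p)\<rfloor>)"
    unfolding in_measure prod.case by linarith
qed simp

declare path_from.simps [simp del]

definition psi :: "nat \<Rightarrow> nat \<Rightarrow> point set \<Rightarrow> point list" where
  "psi M k I = path_from M k I (0, 0)"

section \<open>Failure for \<open>k = 0\<close>\<close>

text \<open>For \<open>k = 0\<close> there are no horizontal steps, so the first case in the definition of the path
  never occurs, and every ideal is mapped to a path consisting of down steps only. As \<open>m\<close> is
  positive, such a path is not in \<open>Qstar (m + 1) 0\<close>; hence the bijection requires \<open>k > 0\<close>.\<close>

lemma last_path_from_0:
  "2 * fst (last (path_from M 0 I p)) + of_int (snd (last (path_from M 0 I p)))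
     = 2 * fst p + of_int (snd p)"
proof (induction M "0::nat" I p rule: path_from.induct)
  case (1 M I p)
  show ?case
  proof (cases "next_point M 0 I p")
    case None
    then show ?thesis by (simp add: path_from.simps)
  next
    case (Some q)
    then have "2 * fst q + of_int (snd q) = 2 * fst p + of_int (snd p)"
      by (cases p) (auto simp: next_point_def split: if_splits)
    moreover have "path_from M 0 I q \<noteq> []" by (subst path_from.simps) simp
    ultimately show ?thesis
      using 1[OF Some] Some by (subst (1 2) path_from.simps) simp
  qed
qed

lemma psi_0_not_bij:
  assumes "m > 0"
  shows "\<not> bij_betw (psi (m + 1) 0) (Jstar m 0) (Qstar (m + 1) 0)"
proof
  assume "bij_betw (psi (m + 1) 0) (Jstar m 0) (Qstar (m + 1) 0)"
  moreover have "{} \<in> Jstar m 0" by (simp add: Jstar_def J_def order_ideal_def)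
  ultimately have "psi (m + 1) 0 {} \<in> Qstar (m + 1) 0" by (auto simp: bij_betw_def)
  then have "last (psi (m + 1) 0 {}) = (real (m + 1) + 1 / 2, -1)"
    by (simp add: Qstar_def Q'_def FB'_def FB_def)
  with last_path_from_0[of "m + 1" "{}" "(0, 0)"] assms show False
    by (simp add: psi_def)
qed

end

(* In the coordinates u = x + (k + 1/2) y and v = x - (k + 1/2) y the visible points are those with
   integer u, and the black points form a set closed under decreasing u and increasing v, while u
   and v are both nondecreasing along a path. The path of an ideal leaves p for q only if no black
   point r with v(p) <= v(r) < v(q) has u(r) > u(p); hence the black points are exactly the points
   of the strip, other than the origin, that lie below some point of the path. This recovers the
   ideal from its path. Conversely, the points below an arbitrary path of Qstar are the black points
   of an ideal, and since nothing black lies in the gap between consecutive points, psi retraces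
   the path. The point (M + 1/2, -1) is always black, so no path passes it; this forces the shape
   of the endpoint. *)
theory Submission
  imports Defs
begin

declare One_nat_def [simp del] \<comment> \<open>otherwise \<open>2 * k + 1\<close> becomes \<open>Suc (2 * k)\<close> and no longer matches\<close>

section \<open>Diagonal coordinates\<close>

definition ucoord :: "nat \<Rightarrow> point \<Rightarrow> real" where
  "ucoord k p = fst p + (real k + 1 / 2) * of_int (snd p)"

definition vcoord :: "nat \<Rightarrow> point \<Rightarrow> real" where
  "vcoord k p = fst p - (real k + 1 / 2) * of_int (snd p)"

definition in_strip :: "nat \<Rightarrow> point \<Rightarrow> bool" where
  "in_strip M p \<longleftrightarrow> visible p \<and> 0 \<le> fst p \<and> fst p \<le> real M + 1 / 2"

text \<open>One downward cone serves both halves of the poset. Covering pairs of \<open>L'\<close>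
  follow it and those of \<open>R'\<close> reverse it, so the complement of an ideal within
  \<open>R'\<close> is again closed downward.\<close>

definition below :: "nat \<Rightarrow> point \<Rightarrow> point \<Rightarrow> bool" where
  "below k r p \<longleftrightarrow> ucoord k r \<le> ucoord k p \<and> vcoord k p \<le> vcoord k r"

definition covered :: "nat \<Rightarrow> point list \<Rightarrow> point \<Rightarrow> bool" where
  "covered k ps r \<longleftrightarrow> (\<exists>p\<in>set ps. below k r p)"

text \<open>The equivalence reverses the membership test below the axis, as the coloring does, so
  that in both halves the covered poset points become the black ones.\<close>

definition ideal_of :: "nat \<Rightarrow> nat \<Rightarrow> point list \<Rightarrow> point set" where
  "ideal_of M k ps = {p \<in> P' (2 * M) (2 * k + 1). 0 \<le> snd p \<longleftrightarrow> covered k ps p}"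

lemma black_iff: "black M I p \<longleftrightarrow> in_strip M p \<and> (0 \<le> snd p \<longleftrightarrow> p \<in> I)"
  by (auto simp: black_def in_strip_def)

lemma ucoord_eq: "ucoord k p = vcoord k p + (2 * real k + 1) * of_int (snd p)"
  by (simp add: ucoord_def vcoord_def algebra_simps)

lemma fst_eq: "2 * fst p = ucoord k p + vcoord k p"
  by (simp add: ucoord_def vcoord_def)

lemma point_eqI:
  assumes "ucoord k p = ucoord k q" "vcoord k p = vcoord k q"
  shows "p = q"
proof -
  have "(2 * real k + 1) * of_int (snd p) = (2 * real k + 1) * of_int (snd q)"
    using assms ucoord_eq[of k p] ucoord_eq[of k q] by linarith
  then have "snd p = snd q"
    by (simp add: add_eq_0_iff)
  moreover have "fst p = fst q"
    using assms fst_eq[of p k] fst_eq[of q k] by linarith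
  ultimately show ?thesis by (simp add: prod_eq_iff)
qed

text \<open>The row term (k + 1/2) y is an integer in even rows and a half-integer in odd rows, so
  both parity cases become integrality of u.\<close>

lemma visible_iff: "visible p \<longleftrightarrow> ucoord k p \<in> \<int>"
proof (cases "even (snd p)")
  case True
  then obtain c where c: "snd p = 2 * c" by blast
  have "ucoord k p = fst p + of_int ((2 * int k + 1) * c)"
    by (simp add: ucoord_def c algebra_simps)
  with True show ?thesis
    by (auto simp: visible_def)
next
  case False
  then obtain c where c: "snd p = 2 * c + 1" by (blast elim: oddE)
  have "ucoord k p = (fst p - 1 / 2) + of_int ((2 * int k + 1) * c + int k + 1)"
    by (simp add: ucoord_def c algebra_simps)
  then have "ucoord k p \<in> \<int> \<longleftrightarrow> fst p - 1 / 2 \<in> \<int>"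
    by (simp only: add_in_Ints_iff_right Ints_of_int)
  with False show ?thesis
    by (auto simp: visible_def)
qed

lemma visible_iff_v: "visible p \<longleftrightarrow> vcoord k p \<in> \<int>"
proof -
  have "ucoord k p = vcoord k p + of_int ((2 * int k + 1) * snd p)"
    by (simp add: ucoord_eq)
  then show ?thesis
    by (simp add: visible_iff[of _ k] del: of_int_mult)
qed

section \<open>Membership in the two halves of the poset\<close>

lemma L'_iff:
  "p \<in> L' (2 * M) (2 * k + 1) \<longleftrightarrow>
     visible p \<and> 0 \<le> snd p \<and> 0 < vcoord k p \<and> ucoord k p \<le> real M" (is "?l \<longleftrightarrow> ?r")
proof
  assume ?l
  then obtain j :: nat and i :: int where
    p: "p = (real_of_int i - real (2 * k + 1) / 2 * real j, int j)"
    and i: "int j * int (2 * k + 1) + 1 \<le> i" "i \<le> \<lfloor>real (2 * M) / 2\<rfloor>"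
    by (auto simp: L'_def)
  \<comment> \<open>The index i of the definition is u itself, and i - j (2k + 1) is v.\<close>
  have u: "ucoord k p = of_int i" by (simp add: ucoord_def p field_simps)
  have v: "vcoord k p = of_int (i - int j * int (2 * k + 1))" by (simp add: vcoord_def p field_simps)
  have "i \<le> int M" "0 < i - int j * int (2 * k + 1)" using i by simp_all
  then have "ucoord k p \<le> real M" "0 < vcoord k p"
    unfolding u v by (simp, simp only: of_int_0_less_iff)
  moreover have "visible p" unfolding visible_iff[of _ k] u by simp
  ultimately show ?r by (simp add: p)
next
  assume r: ?r
  then obtain i where i: "ucoord k p = of_int i" by (auto simp: visible_iff[of _ k] elim: Ints_cases)
  obtain j where j: "snd p = int j" using r nonneg_int_cases by blast
  have "vcoord k p = of_int (i - int j * int (2 * k + 1))"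
    using ucoord_eq[of k p] by (simp add: i j algebra_simps)
  then have "0 < i - int j * int (2 * k + 1)" using r by (simp only: of_int_0_less_iff)
  moreover have "i \<le> \<lfloor>real (2 * M) / 2\<rfloor>" using r i by simp
  moreover have "p = (real_of_int i - real (2 * k + 1) / 2 * real j, int j)"
    using i j by (simp add: prod_eq_iff ucoord_def field_simps)
  ultimately show ?l unfolding L'_def by force
qed

lemma R'_iff:
  "p \<in> R' (2 * M) (2 * k + 1) \<longleftrightarrow>
     visible p \<and> snd p < 0 \<and> 0 < ucoord k p \<and> vcoord k p < real M + real k + 1" (is "?l \<longleftrightarrow> ?r")
proof -
  have "(real (2 * M) + real (2 * k + 1)) / 2 = real_of_int (int M + int k) + 1 / 2"
    by (simp add: field_simps)
  \<comment> \<open>The half-integer rounds up. With i = 2M + 1 - u the lower bound on i then turns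
    into v < M + k + 1.\<close>
  then have ceil: "\<lceil>(real (2 * M) + real (2 * k + 1)) / 2\<rceil> = int M + int k + 1"
    by linarith
  show ?thesis
  proof
    assume ?l
    then obtain j :: nat and i :: int where
      p: "p = (real (2 * M) + 1 - real_of_int i + real (2 * k + 1) / 2 * (real j + 1), - int j - 1)"
      and i: "int j * int (2 * k + 1) + (int M + int k + 1) + 1 \<le> i" "i \<le> int (2 * M)"
      unfolding R'_def ceil by auto
    have u: "ucoord k p = of_int (2 * int M + 1 - i)" by (simp add: ucoord_def p field_simps)
    have v: "vcoord k p = of_int (2 * int M + 1 - i + (2 * int k + 1) * (int j + 1))"
      by (simp add: vcoord_def p field_simps)
    have "0 < 2 * int M + 1 - i" using i by simp
    moreover have "2 * int M + 1 - i + (2 * int k + 1) * (int j + 1) < int M + int k + 1"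
      using i by (simp add: algebra_simps)
    then have "vcoord k p < of_int (int M + int k + 1)"
      unfolding v by (simp only: of_int_less_iff)
    ultimately have "vcoord k p < real M + real k + 1" "0 < ucoord k p"
      unfolding u by (simp, simp only: of_int_0_less_iff)
    moreover have "visible p" unfolding visible_iff[of _ k] u by (rule Ints_of_int)
    ultimately show ?r by (simp add: p)
  next
    assume r: ?r
    then obtain u where u: "ucoord k p = of_int u" by (auto simp: visible_iff[of _ k] elim: Ints_cases)
    define i where "i = 2 * int M + 1 - u"
    define j where "j = nat (- snd p - 1)"
    have j: "snd p = - int j - 1" using r by (simp add: j_def)
    have "vcoord k p = of_int (u + (2 * int k + 1) * (int j + 1))"
      using ucoord_eq[of k p] by (simp add: u j algebra_simps)
    moreover have "vcoord k p < of_int (int M + int k + 1)" using r by simp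
    ultimately have "u + (2 * int k + 1) * (int j + 1) < int M + int k + 1"
      by (simp only: of_int_less_iff)
    then have "int j * int (2 * k + 1) + \<lceil>(real (2 * M) + real (2 * k + 1)) / 2\<rceil> + 1 \<le> i"
      unfolding ceil i_def by (simp add: algebra_simps)
    moreover have "i \<le> int (2 * M)" using r u by (simp add: i_def)
    moreover have "p = (real (2 * M) + 1 - real_of_int i + real (2 * k + 1) / 2 * (real j + 1), - int j - 1)"
      using u j by (simp add: prod_eq_iff ucoord_def i_def field_simps)
    ultimately show ?l unfolding R'_def by blast
  qed
qed

text \<open>Coloring only the strip thus loses no point of an ideal. The origin is singled out
  because a path contains it although it is never black.\<close>

lemma P'_in_strip:
  assumes "p \<in> P' (2 * M) (2 * k + 1)"
  shows "in_strip M p" and "p \<noteq> (0, 0)"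
proof -
  consider "p \<in> L' (2 * M) (2 * k + 1)" | "p \<in> R' (2 * M) (2 * k + 1)"
    using assms by (auto simp: P'_def)
  then have "in_strip M p \<and> p \<noteq> (0, 0)"
  proof cases
    case 1
    then have p: "visible p" "0 \<le> snd p" "0 < vcoord k p" "ucoord k p \<le> real M"
      by (simp_all only: L'_iff)
    then have "0 \<le> (real k + 1 / 2) * of_int (snd p)" by simp
    with p have "0 < fst p" "fst p \<le> real M + 1 / 2"
      unfolding ucoord_def vcoord_def by linarith+
    with p show ?thesis by (auto simp: in_strip_def)
  next
    case 2
    then have p: "visible p" "snd p \<le> -1" "0 < ucoord k p" "vcoord k p < real M + real k + 1"
      by (simp_all only: R'_iff) auto
    then have "(real k + 1 / 2) * of_int (snd p) \<le> (real k + 1 / 2) * (- 1)"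
      by (intro mult_left_mono) auto
    with p show ?thesis by (auto simp: in_strip_def ucoord_def vcoord_def)
  qed
  then show "in_strip M p" "p \<noteq> (0, 0)" by auto
qed

text \<open>From a row to the next lower one, u and v change by dx - (k + 1/2) and dx + (k + 1/2),
  so the bound on |dx| is one inequality for each coordinate.\<close>

lemma adjacent_below:
  assumes "snd r = snd p - 1"
  shows "\<bar>fst r - fst p\<bar> \<le> real k + 1 / 2 \<longleftrightarrow> below k r p"
proof -
  have "(real k + 1 / 2) * of_int (snd r) = (real k + 1 / 2) * of_int (snd p) - (real k + 1 / 2)"
    by (simp add: assms right_diff_distrib)
  then show ?thesis by (auto simp: below_def ucoord_def vcoord_def abs_le_iff)
qed

lemma below_snd_le:
  assumes "below k r p"
  shows "snd r \<le> snd p"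
proof -
  have "(2 * real k + 1) * of_int (snd r) \<le> (2 * real k + 1) * of_int (snd p)"
    using assms ucoord_eq[of k p] ucoord_eq[of k r] unfolding below_def by linarith
  then show ?thesis by (simp add: mult_le_cancel_left)
qed

lemma below_trans: "below k p q \<Longrightarrow> below k q r \<Longrightarrow> below k p r"
  by (auto simp: below_def)


section \<open>Black points of an ideal\<close>

lemma J_subset: "I \<in> J s K \<Longrightarrow> I \<subseteq> P' s K"
  by (simp add: J_def order_ideal_def)

lemma J_covers:
  assumes "I \<in> J s K" "p \<in> I" "covers s K p r"
  shows "r \<in> I"
proof -
  have "poset_le s K r p" using assms(3) by (auto simp: poset_le_def)
  moreover have "r \<in> P' s K" using assms(3) by (auto simp: covers_def P'_def)
  ultimately show ?thesis using assms(1,2) by (auto simp: J_def order_ideal_def)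
qed

lemma order_idealI:
  assumes "I \<subseteq> P' s K" and "\<And>p r. p \<in> I \<Longrightarrow> covers s K p r \<Longrightarrow> r \<in> I"
  shows "order_ideal s K I"
proof -
  have "q \<in> I" if "poset_le s K q p" "p \<in> I" for p q
    using that unfolding poset_le_def
    by (induction rule: converse_rtranclp_induct) (auto intro: assms(2))
  then show ?thesis using assms(1) by (auto simp: order_ideal_def)
qed

lemma in_L'_iff_in_P': "0 \<le> snd p \<Longrightarrow> p \<in> L' (2 * M) (2 * k + 1) \<longleftrightarrow> p \<in> P' (2 * M) (2 * k + 1)"
  by (auto simp only: P'_def Un_iff R'_iff)

lemma in_R'_iff_in_P': "snd p < 0 \<Longrightarrow> p \<in> R' (2 * M) (2 * k + 1) \<longleftrightarrow> p \<in> P' (2 * M) (2 * k + 1)"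
  by (auto simp only: P'_def Un_iff L'_iff)

lemma L'_below:
  assumes "p \<in> L' (2 * M) (2 * k + 1)" "below k r p" "visible r" "0 \<le> snd r"
  shows "r \<in> L' (2 * M) (2 * k + 1)"
  using assms unfolding L'_iff below_def by auto

lemma R'_above:
  assumes "r \<in> R' (2 * M) (2 * k + 1)" "below k r p" "visible p" "snd p < 0"
  shows "p \<in> R' (2 * M) (2 * k + 1)"
  using assms unfolding R'_iff below_def by auto

lemma covers_iff:
  "covers (2 * M) (2 * k + 1) p r \<longleftrightarrow>
     p \<in> L' (2 * M) (2 * k + 1) \<and> r \<in> L' (2 * M) (2 * k + 1) \<and> below k r p \<and> snd r = snd p - 1 \<or>
     p \<in> R' (2 * M) (2 * k + 1) \<and> r \<in> R' (2 * M) (2 * k + 1) \<and> below k p r \<and> snd p = snd r - 1"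
proof -
  have "real (2 * k + 1) / 2 = real k + 1 / 2" by (simp add: field_simps)
  moreover have "snd r = snd p - 1 \<longleftrightarrow> snd p = snd r + 1" "snd p = snd r - 1 \<longleftrightarrow> snd r = snd p + 1"
    by auto
  ultimately show ?thesis
    unfolding covers_def using adjacent_below[of r p k] adjacent_below[of p r k]
    by (auto simp only: abs_minus_commute[of "fst p" "fst r"])
qed

text \<open>Above the axis this is closure of the ideal in \<open>L'\<close>, below it closure in
  \<open>R'\<close> read for the complement. Between rows 0 and -1 it is exactly the ban on close
  pairs in the definition of \<open>J\<close>.\<close>

lemma black_step:
  assumes J: "I \<in> J (2 * M) (2 * k + 1)" and p: "black M I p"
    and r: "in_strip M r" "below k r p" "snd r = snd p - 1"
  shows "black M I r"
proof -
  let ?P = "P' (2 * M) (2 * k + 1)"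
  have vis: "visible p" "visible r" using p r by (auto simp: black_iff in_strip_def)
  consider "1 \<le> snd p" | "snd p = 0" | "snd p < 0" by linarith
  then show ?thesis
  proof cases
    case 1
    then have "p \<in> I" using p by (simp add: black_iff)
    moreover from this have "p \<in> L' (2 * M) (2 * k + 1)"
      using J_subset[OF J] in_L'_iff_in_P'[of p] 1 by auto
    moreover from this have "r \<in> L' (2 * M) (2 * k + 1)"
      using r vis 1 by (auto intro: L'_below)
    ultimately have "r \<in> I" using J_covers[OF J] r unfolding covers_iff by blast
    then show ?thesis using r 1 by (simp add: black_iff)
  next
    case 2
    then have "p \<in> I" using p by (simp add: black_iff)
    have "r \<notin> I"
    proof
      assume "r \<in> I"
      moreover have "p = (fst p, 0)" "r = (fst r, -1)" using 2 r by (simp_all add: prod_eq_iff)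
      moreover have "\<bar>fst p - fst r\<bar> \<le> real (2 * k + 1) / 2"
        using r adjacent_below[of r p k] by (simp add: abs_minus_commute field_simps)
      ultimately show False using J \<open>p \<in> I\<close> unfolding J_def by (metis (mono_tags, lifting) mem_Collect_eq)
    qed
    then show ?thesis using r 2 by (simp add: black_iff)
  next
    case 3
    have "r \<notin> I"
    proof
      assume "r \<in> I"
      then have "r \<in> R' (2 * M) (2 * k + 1)"
        using J_subset[OF J] in_R'_iff_in_P'[of r] r 3 by auto
      moreover from this have "p \<in> R' (2 * M) (2 * k + 1)"
        using r vis 3 by (auto intro: R'_above)
      ultimately have "p \<in> I" using J_covers[OF J \<open>r \<in> I\<close>] r unfolding covers_iff by blast
      then show False using p 3 by (simp add: black_iff)
    qed
    then show ?thesis using r 3 by (simp add: black_iff)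
  qed
qed

text \<open>Going down the cone in single rows might leave the strip at a side. This supplies an
  intermediate point that does not, so that \<open>black_step\<close> can be iterated.\<close>

lemma strip_between:
  assumes p: "in_strip M p" and r: "in_strip M r" and le: "below k r p" and less: "snd r < snd p"
  obtains q where "in_strip M q" "below k r q" "below k q p" "snd q = snd p - 1"
proof (cases "snd r = snd p - 1")
  case True
  then show ?thesis using that[of r] r le by (auto simp: below_def)
next
  case False
  define K where "K = 2 * int k + 1"
  define X where "X = K * snd p"
  define Y where "Y = K * snd r"
  obtain u where u: "ucoord k p = of_int u"
    using p by (auto simp: in_strip_def visible_iff[of _ k] elim: Ints_cases)
  obtain u' where u': "ucoord k r = of_int u'"
    using r by (auto simp: in_strip_def visible_iff[of _ k] elim: Ints_cases)
  have v: "vcoord k p = of_int (u - X)" "vcoord k r = of_int (u' - Y)"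
    using ucoord_eq[of k p] ucoord_eq[of k r] by (simp_all add: u u' X_def Y_def K_def)
  have "u' \<le> u" "u - X \<le> u' - Y"
    using le unfolding below_def u u' v by linarith+
  have pos: "0 \<le> 2 * u - X" "0 \<le> 2 * u' - Y" "2 * u - X \<le> 2 * int M + 1" "2 * u' - Y \<le> 2 * int M + 1"
    using p r fst_eq[of p k] fst_eq[of r k] unfolding in_strip_def u u' v by linarith+
  have "K * snd r \<le> K * (snd p - 2)"
    using False less by (intro mult_left_mono) (auto simp: K_def)
  then have Y: "Y \<le> X - 2 * K" by (simp add: X_def Y_def algebra_simps)
  have "K \<ge> 1" by (simp add: K_def)
  define c where "c = (X - K + 1) div 2" \<comment> \<open>the least \<open>u\<close> with nonnegative abscissa in this row\<close>
  \<comment> \<open>The three lower bounds on u come from the cone of \<open>r\<close>, the cone of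
    \<open>p\<close> and the left edge. Taking the least value allowed leaves the upper bounds to be
    checked for each of the three candidates; the gap of at least two rows gives the room needed for
    \<open>c\<close>.\<close>
  define w where "w = max (max u' (u - K)) c"
  have c: "X - K \<le> 2 * c" "2 * c \<le> X - K + 1" unfolding c_def by linarith+
  have wc: "w = u' \<or> w = u - K \<or> w = c" "u' \<le> w" "u - K \<le> w" "c \<le> w" by (auto simp: w_def)
  have w: "u' \<le> w" "u - K \<le> w" "w \<le> u" "w - (X - K) \<le> u' - Y"
      "0 \<le> 2 * w - (X - K)" "2 * w - (X - K) \<le> 2 * int M + 1"
    using wc \<open>u' \<le> u\<close> \<open>u - X \<le> u' - Y\<close> pos Y \<open>K \<ge> 1\<close> c by linarith+
  define q :: point where "q = (of_int w - (real k + 1 / 2) * of_int (snd p - 1), snd p - 1)"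
  have uq: "ucoord k q = of_int w" by (simp add: ucoord_def q_def)
  have vq: "vcoord k q = of_int (w - (X - K))"
    using ucoord_eq[of k q] by (simp add: uq X_def K_def) (simp add: q_def algebra_simps)
  have "2 * fst q = of_int (2 * w - (X - K))" using fst_eq[of q k] by (simp add: uq vq)
  then have "0 \<le> fst q" "fst q \<le> real M + 1 / 2" using w(5,6) by linarith+
  moreover have "visible q" unfolding visible_iff[of _ k] uq by simp
  ultimately have "in_strip M q" by (simp add: in_strip_def)
  moreover have "below k r q" "below k q p"
    unfolding below_def u u' v uq vq using w by auto
  ultimately show ?thesis using that[of q] by (simp add: q_def)
qed

text \<open>Descend one row at a time through points of \<open>strip_between\<close>. Within a
  single row u - v is constant, so there the cone contains only the point itself.\<close>

lemma black_below:
  assumes J: "I \<in> J (2 * M) (2 * k + 1)" and p: "black M I p"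
    and r: "in_strip M r" "below k r p"
  shows "black M I r"
  using p r(2)
proof (induction "nat (snd p - snd r)" arbitrary: p)
  case 0
  then have "snd r = snd p" using below_snd_le[of k r p] by simp
  moreover have "ucoord k r = vcoord k r + (2 * real k + 1) * of_int (snd r)"
    "ucoord k p = vcoord k p + (2 * real k + 1) * of_int (snd p)" by (rule ucoord_eq)+
  ultimately have "r = p" using 0 by (intro point_eqI[of k]) (auto simp: below_def)
  then show ?case using 0 by simp
next
  case (Suc n)
  then have "in_strip M p" "snd r < snd p" by (auto simp: black_iff)
  from strip_between[OF this(1) r(1) Suc.prems(2) this(2)]
  obtain q where q: "in_strip M q" "below k r q" "below k q p" "snd q = snd p - 1" .
  show ?case
  proof (rule Suc.hyps(1))
    show "n = nat (snd q - snd r)" using Suc.hyps(2) q by simp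
    show "black M I q" using black_step[OF J Suc.prems(1)] q by blast
  qed (fact q)
qed

text \<open>Such points lie outside \<open>R'\<close>, hence outside every ideal. They form a left
  and a right region below the axis whose color does not depend on the ideal.\<close>

lemma black_forced:
  assumes "I \<subseteq> P' (2 * M) (2 * k + 1)" "in_strip M r" "snd r < 0"
    and "ucoord k r \<le> 0 \<or> real M + real k + 1 \<le> vcoord k r"
  shows "black M I r"
proof -
  have "r \<notin> R' (2 * M) (2 * k + 1)" using assms(4) unfolding R'_iff by linarith
  then show ?thesis using assms(1-3) in_R'_iff_in_P'[of r] by (auto simp: black_iff)
qed

lemma black_nonneg_L':
  assumes "I \<subseteq> P' (2 * M) (2 * k + 1)" "black M I r" "0 \<le> snd r"
  shows "r \<in> L' (2 * M) (2 * k + 1)"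
  using assms in_L'_iff_in_P'[of r] by (auto simp: black_iff)

text \<open>The origin has v = 0, so a path starting there has all black points ahead of it in v,
  and its first step cannot go up.\<close>

lemma black_vcoord_pos:
  assumes "I \<subseteq> P' (2 * M) (2 * k + 1)" "black M I r"
  shows "0 < vcoord k r"
proof (cases "0 \<le> snd r")
  case True
  then show ?thesis using black_nonneg_L'[OF assms] unfolding L'_iff by blast
next
  case False
  then have "(real k + 1 / 2) * of_int (snd r) < 0" by (intro mult_pos_neg) auto
  then show ?thesis using assms(2) unfolding vcoord_def black_iff in_strip_def by linarith
qed

section \<open>The path of an ideal\<close>

definition up :: "nat \<Rightarrow> point \<Rightarrow> point" where
  "up k p = (fst p + real k + 1 / 2, snd p + 1)"

definition down :: "nat \<Rightarrow> point \<Rightarrow> point" where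
  "down k p = (fst p + real k + 1 / 2, snd p - 1)"

definition right :: "point \<Rightarrow> nat \<Rightarrow> point" where
  "right p l = (fst p + real l, snd p)"

lemma coord_steps [simp]:
  "ucoord k (up k p) = ucoord k p + 2 * real k + 1" "vcoord k (up k p) = vcoord k p"
  "ucoord k (down k p) = ucoord k p" "vcoord k (down k p) = vcoord k p + 2 * real k + 1"
  "ucoord k (right p l) = ucoord k p + real l" "vcoord k (right p l) = vcoord k p + real l"
  by (simp_all add: ucoord_def vcoord_def up_def down_def right_def distrib_left right_diff_distrib)

lemma point_steps [simp]:
  "fst (up k p) = fst p + real k + 1 / 2" "snd (up k p) = snd p + 1"
  "fst (down k p) = fst p + real k + 1 / 2" "snd (down k p) = snd p - 1"
  "fst (right p l) = fst p + real l" "snd (right p l) = snd p"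
  by (simp_all add: up_def down_def right_def)

lemma visible_steps [simp]:
  "visible (up k p) = visible p" "visible (down k p) = visible p" "visible (right p l) = visible p"
  by (simp add: visible_iff_v[of _ k]) (simp_all add: visible_iff[of _ k])

lemma is_step_iff:
  "is_step (2 * k + 1) p q \<longleftrightarrow>
     q = up k p \<or> q = down k p \<or> (\<exists>l. 1 \<le> l \<and> l \<le> 2 * k \<and> q = right p l)"
  by (auto simp: is_step_def up_def down_def right_def prod_eq_iff field_simps less_Suc_eq_le)

lemma next_point_eq:
  "next_point M k I p =
     (if \<exists>l. 1 \<le> l \<and> l \<le> 2 * k \<and> black M I (right p l) then
        if black M I (up k p) then Some (up k p)
        else Some (right p (LEAST l. 1 \<le> l \<and> l \<le> 2 * k \<and> black M I (right p l)))
      else if black M I (down k p) then Some (down k p) else None)"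
  by (cases p) (auto simp: next_point_def up_def down_def right_def)

lemma next_point_cases:
  assumes "next_point M k I p = Some q"
  obtains (up) "q = up k p" "black M I q"
    | (right) l where "q = right p l" "black M I q" "1 \<le> l" "l \<le> 2 * k" "\<not> black M I (up k p)"
        "\<And>t. 1 \<le> t \<Longrightarrow> t < l \<Longrightarrow> \<not> black M I (right p t)"
    | (down) "q = down k p" "black M I q" "\<And>t. 1 \<le> t \<Longrightarrow> t \<le> 2 * k \<Longrightarrow> \<not> black M I (right p t)"
proof -
  let ?R = "\<lambda>l. 1 \<le> l \<and> l \<le> 2 * k \<and> black M I (right p l)"
  consider "q = up k p" "black M I q"
    | "\<exists>l. ?R l" "\<not> black M I (up k p)" "q = right p (LEAST l. ?R l)"
    | "q = down k p" "black M I q" "\<nexists>l. ?R l"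
    using assms by (auto simp: next_point_eq split: if_splits)
  then show ?thesis
  proof cases
    case 2
    show ?thesis
    proof (rule that(2))
      show "q = right p (LEAST l. ?R l)" "\<not> black M I (up k p)" by fact+
      show "black M I q" "1 \<le> (LEAST l. ?R l)" "(LEAST l. ?R l) \<le> 2 * k"
        using LeastI_ex[OF 2(1)] 2(3) by auto
      show "\<not> black M I (right p t)" if "1 \<le> t" "t < (LEAST l. ?R l)" for t
        using not_less_Least[OF that(2)] that LeastI_ex[OF 2(1)] by auto
    qed
  qed (use that in blast)+
qed

lemma next_point_right:
  assumes "1 \<le> l" "l \<le> 2 * k" "black M I (right p l)" "\<not> black M I (up k p)"
    and "\<And>t. 1 \<le> t \<Longrightarrow> t < l \<Longrightarrow> \<not> black M I (right p t)"
  shows "next_point M k I p = Some (right p l)"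
proof -
  have "(LEAST l. 1 \<le> l \<and> l \<le> 2 * k \<and> black M I (right p l)) = l"
    using assms by (intro Least_equality) (auto simp: not_less[symmetric])
  then show ?thesis using assms by (auto simp: next_point_eq)
qed

text \<open>The point named in the conclusion lies below \<open>r\<close> and in the strip, so it
  inherits blackness. It is one that the rule for the next point inspects.\<close>

lemma overshoot:
  assumes J: "I \<in> J (2 * M) (2 * k + 1)" and p: "in_strip M p" and r: "black M I r"
    and t: "vcoord k r = vcoord k p + real t" "t \<le> 2 * k" and u: "ucoord k p < ucoord k r"
  shows "black M I (if t = 0 then up k p else right p t)"
proof -
  define d where "d = snd r - snd p"
  have ur: "ucoord k r = ucoord k p + real t + (2 * real k + 1) * of_int d"
    using ucoord_eq[of k p] ucoord_eq[of k r] t by (simp add: d_def algebra_simps)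
  \<comment> \<open>Each lower row costs 2k + 1 in u, more than the at most 2k gained from
    \<open>t\<close>.\<close>
  have "d \<ge> 0"
  proof (rule ccontr)
    assume "\<not> d \<ge> 0"
    then have "(2 * real k + 1) * of_int d \<le> (2 * real k + 1) * of_int (- 1)"
      by (intro mult_left_mono) auto
    with ur u t(2) show False by (simp add: algebra_simps)
  qed
  have x: "2 * fst r = 2 * fst p + 2 * real t + (2 * real k + 1) * of_int d"
    using fst_eq[of p k] fst_eq[of r k] ur t by simp
  have rs: "in_strip M r" using r by (simp add: black_iff)
  show ?thesis
  proof (cases "t = 0")
    case True
    have "d \<noteq> 0" using True u ur by auto
    with \<open>d \<ge> 0\<close> have "1 \<le> d" by simp
    define h where "h = (2 * real k + 1) * of_int d"
    have "2 * real k + 1 \<le> h" using \<open>1 \<le> d\<close> by (simp add: h_def)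
    then have "fst p + real k + 1 / 2 \<le> fst r" "ucoord k p + (2 * real k + 1) \<le> ucoord k r"
      using x ur True unfolding h_def[symmetric] by simp_all
    then have "in_strip M (up k p)" "below k (up k p) r"
      using p rs t True by (auto simp: in_strip_def below_def)
    then show ?thesis using black_below[OF J r] True by simp
  next
    case False
    have "0 \<le> (2 * real k + 1) * of_int d" using \<open>d \<ge> 0\<close> by simp
    then have "fst p + real t \<le> fst r" "ucoord k p + real t \<le> ucoord k r"
      using x ur by linarith+
    then have "in_strip M (right p t)" "below k (right p t) r"
      using p rs ur t by (auto simp: in_strip_def below_def)
    then show ?thesis using black_below[OF J r] False by simp
  qed
qed

lemma vcoord_diff_nat:
  assumes "visible p" "visible r" "vcoord k p \<le> vcoord k r"
  obtains t :: nat where "vcoord k r = vcoord k p + real t"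
proof -
  have "vcoord k r - vcoord k p \<in> \<int>" using assms(1,2) by (simp add: visible_iff_v[of _ k])
  then obtain i where i: "vcoord k r - vcoord k p = of_int i" by (auto elim: Ints_cases)
  with assms(3) have "vcoord k r = vcoord k p + real (nat i)" by simp
  then show ?thesis by (rule that)
qed

text \<open>\<open>overshoot\<close> leaves only t = 0 to exclude. Since k is positive,
  \<open>right p 1\<close> lies in the strip and below a black \<open>up k p\<close>, so it would be
  black as well.\<close>

lemma no_right_no_overshoot:
  assumes J: "I \<in> J (2 * M) (2 * k + 1)" and k: "k > 0" and p: "in_strip M p" and r: "black M I r"
    and t: "vcoord k r = vcoord k p + real t" "t \<le> 2 * k"
    and no: "\<And>t. 1 \<le> t \<Longrightarrow> t \<le> 2 * k \<Longrightarrow> \<not> black M I (right p t)"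
  shows "ucoord k r \<le> ucoord k p"
proof (rule ccontr)
  assume "\<not> ?thesis"
  then have b: "black M I (if t = 0 then up k p else right p t)"
    using overshoot[OF J p r t] by simp
  then have "t = 0" using no[of t] t by (cases "t = 0") auto
  with b have up: "black M I (up k p)" by simp
  moreover from this have "in_strip M (right p 1)"
    using k p by (auto simp: black_iff in_strip_def)
  ultimately have "black M I (right p 1)"
    using k by (intro black_below[OF J up]) (auto simp: below_def)
  then show False using no[of 1] k by simp
qed

text \<open>An up step leaves no room in v. For a horizontal step, \<open>overshoot\<close> would
  yield a black upper neighbor or a shorter horizontal step. For a down step the v-gap is at most 2k
  and all right neighbors are white.\<close>

lemma no_overshoot:
  assumes J: "I \<in> J (2 * M) (2 * k + 1)" and k: "k > 0" and p: "in_strip M p" and r: "black M I r"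
    and nxt: "next_point M k I p = Some q"
    and v: "vcoord k p \<le> vcoord k r" "vcoord k r < vcoord k q"
  shows "ucoord k r \<le> ucoord k p"
proof -
  have "visible p" "visible r" using p r by (auto simp: black_iff in_strip_def)
  then obtain t where t: "vcoord k r = vcoord k p + real t"
    using v(1) by (rule vcoord_diff_nat)
  from nxt show ?thesis
  proof (cases rule: next_point_cases)
    case up
    with v show ?thesis by simp
  next
    case (right l)
    then have "t < l" using t v by simp
    show ?thesis
    proof (rule ccontr)
      assume "\<not> ?thesis"
      then have "black M I (if t = 0 then up k p else right p t)"
        using overshoot[OF J p r t] \<open>t < l\<close> right by simp
      then show False using right \<open>t < l\<close> by (cases "t = 0") auto
    qed
  next
    case down
    then have "real t < real (2 * k + 1)" using t v by simp
    then have "t \<le> 2 * k" by linarith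
    from no_right_no_overshoot[OF J k p r t this down(3)] show ?thesis by blast
  qed
qed

text \<open>The origin starts every path but is white, as it does not belong to the poset.\<close>

definition path_inv :: "nat \<Rightarrow> nat \<Rightarrow> point set \<Rightarrow> point \<Rightarrow> bool" where
  "path_inv M k I p \<longleftrightarrow>
     in_strip M p \<and> (p = (0, 0) \<or> black M I p) \<and> vcoord k p \<le> real M + real k + 1"

text \<open>A path can only stop because a down step would leave the strip on the right: inside the
  strip that point is black, by closure if \<open>p\<close> is black and by
  \<open>black_forced\<close>, with u = 0, if \<open>p\<close> is the origin.\<close>

lemma next_None:
  assumes J: "I \<in> J (2 * M) (2 * k + 1)" and p: "path_inv M k I p"
    and nxt: "next_point M k I p = None"
  shows "real M < fst p + real k" and "\<And>t. 1 \<le> t \<Longrightarrow> t \<le> 2 * k \<Longrightarrow> \<not> black M I (right p t)"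
proof -
  show no: "\<not> black M I (right p t)" if "1 \<le> t" "t \<le> 2 * k" for t
    using nxt that by (auto simp: next_point_eq split: if_splits)
  have nd: "\<not> black M I (down k p)"
    using nxt by (auto simp: next_point_eq split: if_splits)
  have "\<not> in_strip M (down k p)"
  proof
    assume d: "in_strip M (down k p)"
    from p consider "p = (0, 0)" | "black M I p" by (auto simp: path_inv_def)
    then have "black M I (down k p)"
    proof cases
      case 1
      then show ?thesis using d by (intro black_forced[OF J_subset[OF J]]) (auto simp: ucoord_def[of k "(0, 0)"])
    next
      case 2
      then show ?thesis using d by (intro black_below[OF J 2]) (auto simp: below_def)
    qed
    with nd show False by simp
  qed
  then show "real M < fst p + real k" using p by (auto simp: path_inv_def in_strip_def)
qed

text \<open>The path stops so close to the right edge that any \<open>r\<close> with larger u and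
  v-distance above 2k would lie outside the strip. The remaining distances are those where a right
  neighbor of \<open>p\<close> would be black.\<close>

lemma no_overshoot_last:
  assumes J: "I \<in> J (2 * M) (2 * k + 1)" and k: "k > 0" and p: "path_inv M k I p" and r: "black M I r"
    and nxt: "next_point M k I p = None" and v: "vcoord k p \<le> vcoord k r"
  shows "ucoord k r \<le> ucoord k p"
proof (rule ccontr)
  assume u: "\<not> ?thesis"
  have ps: "in_strip M p" using p by (simp add: path_inv_def)
  then have "visible p" "visible r" using r by (auto simp: black_iff in_strip_def)
  then obtain t where t: "vcoord k r = vcoord k p + real t"
    using v by (rule vcoord_diff_nat)
  have "fst r \<le> real M + 1 / 2" using r by (simp add: black_iff in_strip_def)
  then have "real t < real (2 * k + 1)"
    using next_None(1)[OF J p nxt] fst_eq[of p k] fst_eq[of r k] t u by simp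
  then have "t \<le> 2 * k" by linarith
  from no_right_no_overshoot[OF J k ps r t this next_None(2)[OF J p nxt]] u show False by blast
qed

text \<open>Its v-coordinate is exactly the first value that \<open>R'\<close> excludes, so its
  color is forced.\<close>

lemma corner:
  assumes "I \<subseteq> P' (2 * M) (2 * k + 1)"
  defines "E \<equiv> (real M + 1 / 2, - 1) :: point"
  shows "black M I E" and "ucoord k E = real M - real k" and "vcoord k E = real M + real k + 1"
proof -
  show u: "ucoord k E = real M - real k" and v: "vcoord k E = real M + real k + 1"
    by (simp_all add: E_def ucoord_def vcoord_def)
  have "visible E" by (simp add: E_def visible_def)
  then show "black M I E"
    using v by (intro black_forced[OF assms(1)]) (simp_all add: in_strip_def, simp_all add: E_def)
qed

text \<open>The bound on v is that of the corner. A step beyond it would pass the corner in v, so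
  \<open>no_overshoot\<close> makes u at least M - k, and the two bounds together put
  \<open>q\<close> outside the strip.\<close>

lemma next_point_inv:
  assumes J: "I \<in> J (2 * M) (2 * k + 1)" and k: "k > 0" and p: "path_inv M k I p"
    and nxt: "next_point M k I p = Some q"
  shows "path_inv M k I q" "is_step (2 * k + 1) p q"
proof -
  have q: "black M I q" using nxt by (cases rule: next_point_cases)
  show st: "is_step (2 * k + 1) p q"
    unfolding is_step_iff using nxt by (cases rule: next_point_cases) auto
  have "vcoord k q \<le> real M + real k + 1"
  proof (rule ccontr)
    assume v: "\<not> ?thesis"
    note E = corner[OF J_subset[OF J]]
    have "real M - real k \<le> ucoord k p"
      using no_overshoot[OF J k _ E(1) nxt] p v unfolding E path_inv_def by simp
    also have "\<dots> \<le> ucoord k q" using st by (auto simp: is_step_iff)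
    finally have "real M + 1 / 2 < fst q" using v fst_eq[of q k] by simp
    then show False using q by (simp add: black_iff in_strip_def)
  qed
  with q show "path_inv M k I q" by (simp add: path_inv_def black_iff)
qed

section \<open>Properties of the whole path\<close>

lemma path_from_neq_Nil [simp]: "path_from M k I p \<noteq> []"
  by (subst path_from.simps) simp

lemma hd_path_from [simp]: "hd (path_from M k I p) = p"
  by (subst path_from.simps) simp

text \<open>For the last claim, locate v of \<open>r\<close> among the values along the path: the
  final path point whose v does not exceed it covers \<open>r\<close>, by
  \<open>no_overshoot\<close> or, at the end, by \<open>no_overshoot_last\<close>.\<close>

lemma path_from_inv:
  assumes J: "I \<in> J (2 * M) (2 * k + 1)" and k: "k > 0" and p: "path_inv M k I p"
  shows "\<forall>q\<in>set (path_from M k I p). path_inv M k I q"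
    and "successively (is_step (2 * k + 1)) (path_from M k I p)"
    and "next_point M k I (last (path_from M k I p)) = None"
    and "black M I r \<Longrightarrow> vcoord k p \<le> vcoord k r \<Longrightarrow> covered k (path_from M k I p) r"
proof -
  have "(\<forall>q\<in>set (path_from M k I p). path_inv M k I q) \<and>
    successively (is_step (2 * k + 1)) (path_from M k I p) \<and>
    next_point M k I (last (path_from M k I p)) = None \<and>
    (\<forall>r. black M I r \<longrightarrow> vcoord k p \<le> vcoord k r \<longrightarrow> covered k (path_from M k I p) r)"
    using J k p
  proof (induction M k I p rule: path_from.induct)
    case (1 M k I p)
    show ?case
    proof (cases "next_point M k I p")
      case None
      then have "path_from M k I p = [p]" by (subst path_from.simps) simp
      then show ?thesis
        using no_overshoot_last[OF 1(2-4) _ None] 1(4) None by (auto simp: covered_def below_def)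
    next
      case (Some q)
      note q = next_point_inv[OF 1(2-4) Some]
      note IH = 1(1)[OF Some 1(2,3) q(1)]
      have eq: "path_from M k I p = p # path_from M k I q"
        using Some by (subst path_from.simps) simp
      have "covered k (path_from M k I p) r" if "black M I r" "vcoord k p \<le> vcoord k r" for r
      proof (cases "vcoord k q \<le> vcoord k r")
        case True
        with IH that have "covered k (path_from M k I q) r" by blast
        then show ?thesis by (simp add: eq covered_def)
      next
        case False
        then show ?thesis
          using no_overshoot[OF 1(2,3) _ that(1) Some that(2)] that 1(4)
          by (auto simp: eq covered_def below_def path_inv_def)
      qed
      with IH q 1(4) show ?thesis by (auto simp: eq successively_Cons)
    qed
  qed
  then show "\<forall>q\<in>set (path_from M k I p). path_inv M k I q"
    and "successively (is_step (2 * k + 1)) (path_from M k I p)"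
    and "next_point M k I (last (path_from M k I p)) = None"
    and "black M I r \<Longrightarrow> vcoord k p \<le> vcoord k r \<Longrightarrow> covered k (path_from M k I p) r"
    by blast+
qed

section \<open>Recovering the ideal, and the endpoint of its path\<close>

lemma origin_coords [simp]: "ucoord k (0, 0) = 0" "vcoord k (0, 0) = 0"
  by (simp_all add: ucoord_def vcoord_def)

lemma path_inv_origin: "path_inv M k I (0, 0)"
  by (simp add: path_inv_def in_strip_def visible_def)


text \<open>Points below a black path point are black by closure. Strip points below the white
  origin, other than itself, have negative ordinate and u at most 0, so they are forced
  black.\<close>

lemma black_iff_covered:
  assumes J: "I \<in> J (2 * M) (2 * k + 1)" and k: "k > 0" and r: "in_strip M r" "r \<noteq> (0, 0)"
  shows "black M I r \<longleftrightarrow> covered k (psi M k I) r"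
proof
  assume b: "black M I r"
  show "covered k (psi M k I) r"
    unfolding psi_def using black_vcoord_pos[OF J_subset[OF J] b]
    by (intro path_from_inv(4)[OF J k path_inv_origin b]) simp
next
  assume "covered k (psi M k I) r"
  then obtain p where p: "path_inv M k I p" "below k r p"
    using path_from_inv(1)[OF J k path_inv_origin] by (auto simp: psi_def covered_def)
  show "black M I r"
  proof (cases "p = (0, 0)")
    case True
    then have uv: "ucoord k r \<le> 0" "0 \<le> vcoord k r" using p by (auto simp: below_def)
    have "snd r \<le> 0" using below_snd_le[OF p(2)] True by simp
    moreover have "snd r \<noteq> 0"
    proof
      assume "snd r = 0"
      then have "fst r = 0" using uv by (simp add: ucoord_def vcoord_def)
      then show False using r(2) \<open>snd r = 0\<close> by (simp add: prod_eq_iff)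
    qed
    ultimately show ?thesis
      using r(1) uv by (intro black_forced[OF J_subset[OF J]]) auto
  next
    case False
    then have "black M I p" using p by (simp add: path_inv_def)
    from black_below[OF J this r(1) p(2)] show ?thesis .
  qed
qed

lemma ideal_of_psi:
  assumes J: "I \<in> J (2 * M) (2 * k + 1)" and k: "k > 0"
  shows "ideal_of M k (psi M k I) = I"
proof (rule set_eqI)
  fix p
  show "p \<in> ideal_of M k (psi M k I) \<longleftrightarrow> p \<in> I"
  proof (cases "p \<in> P' (2 * M) (2 * k + 1)")
    case True
    from black_iff_covered[OF J k P'_in_strip[OF this]] P'_in_strip(1)[OF this] True
    show ?thesis by (auto simp: ideal_of_def black_iff)
  next
    case False
    then show ?thesis using J_subset[OF J] by (auto simp: ideal_of_def)
  qed
qed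

text \<open>Below the axis, comparison with the corner gives u >= M - k and v <= M + k + 1, while v
  - u >= 2k + 1, so equality holds throughout. Otherwise x > M - k together with u <= M leaves only
  row 0.\<close>

lemma final_point:
  assumes J: "I \<in> J (2 * M) (2 * k + 1)" and I: "(real M, 0) \<notin> I" and k: "k > 0" and M: "M > 0"
    and p: "path_inv M k I p" and nxt: "next_point M k I p = None"
  shows "p = (real M + 1 / 2, - 1) \<or> (\<exists>i. 0 < i \<and> i < k \<and> p = (real M - real i, 0))"
proof (cases "snd p < 0")
  case True
  note E = corner[OF J_subset[OF J]]
  have v: "vcoord k p \<le> real M + real k + 1" using p by (simp add: path_inv_def)
  have "real M - real k \<le> ucoord k p"
    using no_overshoot_last[OF J k p E(1) nxt] v unfolding E by simp
  moreover have "(2 * real k + 1) * of_int (snd p) \<le> (2 * real k + 1) * of_int (- 1)"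
    using True by (intro mult_left_mono) auto
  ultimately have "ucoord k p = real M - real k" "vcoord k p = real M + real k + 1"
    using v ucoord_eq[of k p] by simp_all
  then have "p = (real M + 1 / 2, - 1)" by (intro point_eqI[of k]) (simp_all only: E)
  then show ?thesis ..
next
  case False
  have x: "real M < fst p + real k" using next_None(1)[OF J p nxt] .
  show ?thesis
  proof (cases "p = (0, 0)")
    case True
    with x have "0 < M \<and> M < k \<and> p = (real M - real M, 0)" using M by simp
    then show ?thesis by blast
  next
    case False
    then have b: "black M I p" using p by (simp add: path_inv_def)
    have L: "ucoord k p \<le> real M"
      using black_nonneg_L'[OF J_subset[OF J] b] \<open>\<not> snd p < 0\<close> unfolding L'_iff by simp
    have "snd p = 0"
    proof (rule ccontr)
      assume "snd p \<noteq> 0"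
      then have "1 \<le> snd p" using \<open>\<not> snd p < 0\<close> by simp
      define h where "h = (real k + 1 / 2) * of_int (snd p)"
      have "real k + 1 / 2 \<le> h" using \<open>1 \<le> snd p\<close> by (simp add: h_def)
      with x L show False unfolding ucoord_def h_def[symmetric] by simp
    qed
    then have "p \<in> I" using b by (simp add: black_iff)
    then have "fst p \<noteq> real M" using I \<open>snd p = 0\<close> by (metis prod.collapse)
    moreover have "ucoord k p = fst p" using \<open>snd p = 0\<close> by (simp add: ucoord_def)
    moreover from this obtain a where a: "fst p = of_int a"
      using b by (auto simp: black_iff in_strip_def visible_iff[of _ k] elim: Ints_cases)
    ultimately have "0 < int M - a" "int M - a < int k" using x L by auto
    then have "0 < nat (int M - a)" "nat (int M - a) < k" "p = (real M - real (nat (int M - a)), 0)"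
      using a \<open>snd p = 0\<close> by (auto simp: prod_eq_iff)
    then show ?thesis by blast
  qed
qed

text \<open>The endpoint tells the pieces of \<open>Q'\<close> apart, so removing the paths ending
  at (M, 0) deletes exactly the index 0.\<close>

lemma Qstar_iff:
  assumes "M > 0" "k > 0"
  shows "ps \<in> Qstar M k \<longleftrightarrow>
    ps \<noteq> [] \<and> hd ps = (0, 0) \<and> successively (is_step (2 * k + 1)) ps \<and>
    (length ps \<ge> 2 \<longrightarrow> snd (ps ! 1) - snd (ps ! 0) \<in> {0, -1}) \<and>
    (last ps = (real M + 1 / 2, - 1) \<or> (\<exists>i. 0 < i \<and> i < k \<and> last ps = (real M - real i, 0)))"
  by (auto simp: Qstar_def Q'_def FB'_def FB_def)

lemma psi_in_Qstar:
  assumes J: "I \<in> J (2 * M) (2 * k + 1)" and I: "(real M, 0) \<notin> I" and k: "k > 0" and M: "M > 0"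
  shows "psi M k I \<in> Qstar M k"
proof -
  let ?ps = "path_from M k I (0, 0)"
  note inv = path_from_inv[OF J k path_inv_origin]
  have "path_inv M k I (last ?ps)" using inv(1) by simp
  then have "last ?ps = (real M + 1 / 2, - 1) \<or> (\<exists>i. 0 < i \<and> i < k \<and> last ?ps = (real M - real i, 0))"
    using inv(3) by (rule final_point[OF J I k M])
  moreover have "snd (?ps ! 1) - snd (?ps ! 0) \<in> {0, -1}" if "length ?ps \<ge> 2"
  proof (cases "next_point M k I (0, 0)")
    case None
    then have "?ps = [(0, 0)]" by (subst path_from.simps) simp
    with that show ?thesis by simp
  next
    case (Some q)
    then have "?ps = (0, 0) # path_from M k I q" by (subst path_from.simps) simp
    moreover from this have "?ps ! 1 = q"
      by (simp add: One_nat_def hd_conv_nth[symmetric])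
    moreover from Some have "snd q \<in> {0, -1}"
    proof (cases rule: next_point_cases)
      \<comment> \<open>An up step from the origin would keep v = 0, which no black point
        has.\<close>
      case up
      then show ?thesis using black_vcoord_pos[OF J_subset[OF J] up(2)] by simp
    qed auto
    ultimately show ?thesis by simp
  qed
  ultimately show ?thesis
    unfolding Qstar_iff[OF M k] psi_def using inv(2) by simp
qed

section \<open>The ideal of a path\<close>

locale star_path =
  fixes M k :: nat and Q :: "point list"
  assumes M: "M > 0" and k: "k > 0" and Q: "Q \<in> Qstar M k"
begin

section \<open>Monotonicity along a path\<close>

lemma hd_Q: "Q \<noteq> []" "hd Q = (0, 0)"
  using Q by (simp_all add: Qstar_iff[OF M k])

lemma steps: "successively (is_step (2 * k + 1)) Q"
  using Q by (simp add: Qstar_iff[OF M k])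

lemma last_Q: "last Q = (real M + 1 / 2, - 1) \<or> (\<exists>i. 0 < i \<and> i < k \<and> last Q = (real M - real i, 0))"
  using Q by (simp add: Qstar_iff[OF M k])

lemma last_coords:
  "real M - real k \<le> ucoord k (last Q)" "ucoord k (last Q) < real M"
  "vcoord k (last Q) \<le> real M + real k + 1" "fst (last Q) \<le> real M + 1 / 2"
  using last_Q k by (auto simp: ucoord_def vcoord_def)

text \<open>Visibility is carried along so that one transitive relation transports everything needed
  for \<open>in_strip\<close> from the origin through the path.\<close>

definition later :: "point \<Rightarrow> point \<Rightarrow> bool" where
  "later p q \<longleftrightarrow> ucoord k p \<le> ucoord k q \<and> vcoord k p \<le> vcoord k q \<and> (visible p \<longrightarrow> visible q)"

lemma sorted: "sorted_wrt later Q"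
proof -
  have "transp later" by (auto simp: later_def transp_def)
  moreover have "successively later Q"
    using steps by (rule successively_mono) (auto simp: is_step_iff later_def)
  ultimately show ?thesis by (simp add: successively_conv_sorted_wrt)
qed

lemma later_refl [simp]: "later p p"
  by (simp add: later_def)

lemma between:
  assumes "p \<in> set Q"
  shows "later (0, 0) p" "later p (last Q)"
proof -
  obtain xs ys where Qs: "Q = xs @ p # ys" using assms by (meson split_list)
  have s: "sorted_wrt later (xs @ p # ys)" using sorted Qs by simp
  show "later (0, 0) p"
    using hd_Q s by (cases xs) (auto simp: Qs)
  show "later p (last Q)"
    using s by (cases ys rule: rev_cases) (auto simp: Qs sorted_wrt_append)
qed

lemma in_strip_Q:
  assumes "p \<in> set Q"
  shows "in_strip M p"
  using between[OF assms] fst_eq[of p k] fst_eq[of "last Q" k] last_coords(4)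
  by (auto simp: in_strip_def later_def visible_def)

text \<open>The restriction on the first step enters here: a horizontal or down step strictly raises
  v, and later steps never lower it.\<close>

lemma vcoord_pos:
  assumes "Q = (0, 0) # ps" "p \<in> set ps"
  shows "0 < vcoord k p"
proof -
  obtain q qs where ps: "ps = q # qs" using assms(2) by (cases ps) auto
  have "snd q \<in> {0, -1}" using Q by (auto simp: Qstar_iff[OF M k] assms(1) ps One_nat_def)
  moreover have "is_step (2 * k + 1) (0, 0) q" using steps by (simp add: assms(1) ps)
  ultimately have "0 < vcoord k q" by (auto simp: is_step_iff)
  moreover have "p = q \<or> later q p" using sorted assms by (auto simp: ps)
  ultimately show ?thesis by (auto simp: later_def)
qed

lemma Q_Cons: "Q = (0, 0) # tl Q"
  using hd_Q by (metis list.collapse)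

lemma covered_vcoord_pos:
  assumes "covered k Q r" "in_strip M r" "r \<noteq> (0, 0)"
  shows "0 < vcoord k r"
proof -
  obtain p where p: "p \<in> set Q" "below k r p" using assms(1) by (auto simp: covered_def)
  then consider "p = (0, 0)" | "p \<in> set (tl Q)" using Q_Cons by (metis set_ConsD)
  then show ?thesis
  proof cases
    case 1
    then have uv: "ucoord k r \<le> 0" "0 \<le> vcoord k r" using p by (auto simp: below_def)
    have "vcoord k r \<noteq> 0"
    proof
      assume "vcoord k r = 0"
      moreover from this have "ucoord k r = 0"
        using uv fst_eq[of r k] assms(2) by (simp add: in_strip_def)
      ultimately have "r = (0, 0)" by (intro point_eqI[of k]) simp_all
      with assms(3) show False ..
    qed
    with uv show ?thesis by simp
  next
    case 2
    then have "0 < vcoord k p" by (rule vcoord_pos[OF Q_Cons])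
    then show ?thesis using p(2) by (simp add: below_def)
  qed
qed

text \<open>The bound is strict because the endpoints at height 0 have i > 0 and the corner has u =
  M - k with k > 0. Hence (M, 0) stays out of the ideal.\<close>

lemma covered_ucoord: "covered k Q r \<Longrightarrow> ucoord k r < real M"
  using between(2) last_coords(2) by (fastforce simp: covered_def below_def later_def)

text \<open>The left region of forced color lies below the origin, and the right one below the
  endpoint of the path.\<close>

lemma covered_outside_R':
  assumes "in_strip M r" "snd r < 0" "r \<notin> R' (2 * M) (2 * k + 1)"
  shows "covered k Q r"
proof -
  have x: "0 \<le> fst r" "fst r \<le> real M + 1 / 2" using assms(1) by (auto simp: in_strip_def)
  consider "ucoord k r \<le> 0" | "real M + real k + 1 \<le> vcoord k r"
    using assms unfolding R'_iff in_strip_def by linarith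
  then show ?thesis
  proof cases
    case 1
    then have "below k r (hd Q)" using x fst_eq[of r k] by (simp add: below_def hd_Q)
    then show ?thesis using hd_in_set[OF hd_Q(1)] unfolding covered_def by blast
  next
    case 2
    then have "below k r (last Q)" using x fst_eq[of r k] last_coords by (simp add: below_def)
    then show ?thesis using last_in_set[OF hd_Q(1)] unfolding covered_def by blast
  qed
qed

text \<open>Cutting down to the poset in \<open>ideal_of\<close> does no harm: covered strip points
  on or above the axis, except the origin, satisfy the bounds of \<open>L'\<close>, and strip points
  below the axis outside the poset are covered anyway.\<close>

lemma black_ideal_of:
  "black M (ideal_of M k Q) r \<longleftrightarrow> in_strip M r \<and> r \<noteq> (0, 0) \<and> covered k Q r"
proof (cases "0 \<le> snd r")
  case True
  have "r \<in> P' (2 * M) (2 * k + 1)" if "in_strip M r" "r \<noteq> (0, 0)" "covered k Q r"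
    using covered_vcoord_pos[OF that(3,1,2)] covered_ucoord[OF that(3)] that(1) True
    unfolding in_L'_iff_in_P'[OF True, symmetric] L'_iff in_strip_def by simp
  then show ?thesis using True P'_in_strip(2)[of r] by (auto simp: black_iff ideal_of_def)
next
  case False
  then have "covered k Q r" if "in_strip M r" "r \<notin> P' (2 * M) (2 * k + 1)"
    using covered_outside_R' that in_R'_iff_in_P'[of r] by simp
  then show ?thesis using False by (auto simp: black_iff ideal_of_def)
qed

text \<open>All conditions reduce to \<open>mono\<close>. A forbidden pair would be an uncovered
  point below a covered one.\<close>

lemma ideal_of_in_J: "ideal_of M k Q \<in> J (2 * M) (2 * k + 1)"
proof -
  have mono: "covered k Q r" if "covered k Q p" "below k r p" for p r
    using that by (auto simp: covered_def intro: below_trans)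
  have "order_ideal (2 * M) (2 * k + 1) (ideal_of M k Q)"
  proof (rule order_idealI)
    fix p r
    assume p: "p \<in> ideal_of M k Q" and "covers (2 * M) (2 * k + 1) p r"
    then consider
        "p \<in> L' (2 * M) (2 * k + 1)" "r \<in> L' (2 * M) (2 * k + 1)" "below k r p"
      | "p \<in> R' (2 * M) (2 * k + 1)" "r \<in> R' (2 * M) (2 * k + 1)" "below k p r"
      unfolding covers_iff by blast
    then show "r \<in> ideal_of M k Q"
    proof cases
      case 1
      moreover from this have "0 \<le> snd p" "0 \<le> snd r" unfolding L'_iff by simp_all
      ultimately show ?thesis using p mono by (auto simp: ideal_of_def P'_def)
    next
      case 2
      moreover from this have "snd p < 0" "snd r < 0" unfolding R'_iff by simp_all
      ultimately show ?thesis using p mono[of r p] by (auto simp: ideal_of_def P'_def)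
    qed
  qed (auto simp: ideal_of_def)
  moreover have False
    if a: "(a, 0) \<in> ideal_of M k Q" "(a', - 1) \<in> ideal_of M k Q" "\<bar>a - a'\<bar> \<le> real (2 * k + 1) / 2" for a a'
  proof -
    have "below k (a', - 1) (a, 0)"
      using a(3) adjacent_below[of "(a', - 1)" "(a, 0)" k]
      by (simp add: abs_minus_commute field_simps)
    then show False using a mono by (auto simp: ideal_of_def)
  qed
  ultimately show ?thesis by (auto simp: J_def)
qed

lemma corner_notin_ideal_of: "(real M, 0) \<notin> ideal_of M k Q"
  using covered_ucoord[of "(real M, 0)"] by (auto simp: ideal_of_def ucoord_def)

text \<open>Path points up to \<open>p\<close> have too small a u to cover \<open>r\<close>, and
  those after \<open>p\<close> have too large a v.\<close>

lemma not_covered_gap: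
  assumes "Q = xs @ p # ys" "ucoord k p < ucoord k r" "ys \<noteq> [] \<Longrightarrow> vcoord k r < vcoord k (hd ys)"
  shows "\<not> black M (ideal_of M k Q) r"
proof -
  have s: "sorted_wrt later (xs @ p # ys)" using sorted assms(1) by simp
  have "\<not> below k r q" if "q \<in> set Q" for q
  proof -
    have "later q p \<or> q \<in> set ys"
      using that s by (auto simp: assms(1) sorted_wrt_append)
    then consider "later q p" | "q \<in> set ys" by blast
    then show ?thesis
    proof cases
      case 1
      then show ?thesis using assms(2) by (auto simp: later_def below_def)
    next
      case 2
      then have "later (hd ys) q" using s by (cases ys) (auto simp: sorted_wrt_append)
      then show ?thesis using assms(3) 2 by (force simp: later_def below_def)
    qed
  qed
  then show ?thesis by (simp add: black_ideal_of covered_def)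
qed

text \<open>Induction on the rest of the path. For horizontal and down steps, every black point that
  would divert \<open>psi\<close> to another successor would lie in the gap just shown to be
  white.\<close>

lemma path_from_ideal_of:
  assumes "Q = xs @ p # ys"
  shows "path_from M k (ideal_of M k Q) p = p # ys"
  using assms
proof (induction ys arbitrary: xs p)
  case Nil
  let ?I = "ideal_of M k Q"
  have p: "last Q = p" using Nil by simp
  have "\<not> black M ?I (right p l)" if "1 \<le> l" for l
    using that by (intro not_covered_gap[OF Nil]) simp_all
  \<comment> \<open>Every admissible endpoint has abscissa above M - k, so a down step leaves the
    strip.\<close>
  moreover have "\<not> black M ?I (down k p)"
    using last_Q by (auto simp: p black_iff in_strip_def)
  ultimately have "next_point M k ?I p = None" by (auto simp: next_point_eq)
  then show ?case by (subst path_from.simps) simp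
next
  case (Cons q ys)
  let ?I = "ideal_of M k Q"
  have gap: "\<not> black M ?I r" if "ucoord k p < ucoord k r" "vcoord k r < vcoord k q" for r
    using that by (intro not_covered_gap[OF Cons.prems]) simp_all
  have "q \<in> set (tl Q)" using Cons.prems by (cases xs) auto
  then have "0 < vcoord k q" by (rule vcoord_pos[OF Q_Cons])
  moreover have "q \<in> set Q" using Cons.prems by simp
  ultimately have q: "black M ?I q"
    unfolding black_ideal_of using in_strip_Q by (auto simp: covered_def below_def)
  have p: "in_strip M p" using in_strip_Q Cons.prems by simp
  have "is_step (2 * k + 1) p q"
    using steps unfolding Cons.prems by (simp add: successively_append_iff)
  then consider "q = up k p" | l where "1 \<le> l" "l \<le> 2 * k" "q = right p l" | "q = down k p"
    unfolding is_step_iff by blast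
  then have "next_point M k ?I p = Some q"
  proof cases
    case 1
    \<comment> \<open>The rule tries an up step only if some right neighbor is black; the nearest
      one is, since it lies below \<open>q\<close>.\<close>
    have "in_strip M (right p 1)" using p q k by (auto simp: 1 black_iff in_strip_def)
    then have "black M ?I (right p 1)"
      using k by (intro black_below[OF ideal_of_in_J q]) (auto simp: 1 below_def)
    then have "\<exists>l. 1 \<le> l \<and> l \<le> 2 * k \<and> black M ?I (right p l)"
      using k by (intro exI[of _ 1]) simp
    then show ?thesis using q by (simp add: next_point_eq 1)
  next
    case (2 l)
    show ?thesis unfolding 2(3)
    proof (rule next_point_right[OF 2(1,2)])
      show "black M ?I (right p l)" using q 2 by simp
      show "\<not> black M ?I (up k p)" using 2 by (intro gap) simp_all
      show "\<not> black M ?I (right p t)" if "1 \<le> t" "t < l" for t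
        using that 2 by (intro gap) simp_all
    qed
  next
    case 3
    have "\<not> black M ?I (right p l)" if "1 \<le> l" "l \<le> 2 * k" for l
      using that by (intro gap) (auto simp: 3)
    then show ?thesis using q 3 by (auto simp: next_point_eq)
  qed
  moreover have "path_from M k ?I q = q # ys" using Cons.IH[of "xs @ [p]"] Cons.prems by simp
  ultimately show ?case by (subst path_from.simps) simp
qed

lemma psi_ideal_of: "psi M k (ideal_of M k Q) = Q"
  unfolding psi_def using path_from_ideal_of[of "[]" "(0, 0)" "tl Q"] Q_Cons by simp

end

section \<open>The bijection\<close>

theorem theorem2p28:
  fixes m k :: nat
  assumes "m > 0" and "k > 0"
  shows "bij_betw (psi (m + 1) k) (Jstar m k) (Qstar (m + 1) k)"
proof (rule bij_betw_byWitness[where f' = "ideal_of (m + 1) k"])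
  have Jstar: "Jstar m k = {I \<in> J (2 * (m + 1)) (2 * k + 1). (real (m + 1), 0) \<notin> I}"
    by (simp add: Jstar_def algebra_simps)
  have path: "star_path (m + 1) k Q" if "Q \<in> Qstar (m + 1) k" for Q
    using that assms by unfold_locales auto
  show "\<forall>I\<in>Jstar m k. ideal_of (m + 1) k (psi (m + 1) k I) = I"
    unfolding Jstar using ideal_of_psi assms(2) by blast
  show "\<forall>Q\<in>Qstar (m + 1) k. psi (m + 1) k (ideal_of (m + 1) k Q) = Q"
    using path star_path.psi_ideal_of by blast
  show "psi (m + 1) k ` Jstar m k \<subseteq> Qstar (m + 1) k"
    unfolding Jstar using psi_in_Qstar assms(2) by auto
  show "ideal_of (m + 1) k ` Qstar (m + 1) k \<subseteq> Jstar m k"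
    unfolding Jstar using path star_path.ideal_of_in_J star_path.corner_notin_ideal_of by blast
qed

end
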